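(* Let $p\in\mathbb{C}[z_1,z_2]$ be semi-stable and $q\in\mathcal{I}_p$. Then $q/p$ is non-tangentially bounded at every point of $\mathbb{T}^2$; equivalently, if $p$ vanishes to order $M$ at some point of $\mathbb{T}^2$, then every element of $\mathcal{I}_p$ vanishes to order at least $M$ at that point.
   Context: $\mathbb{D}$ is the open unit disk, $\mathbb{T}$ the unit circle. For $p$ of bidegree $(n,m)$, $\tilde p(z)=z_1^nz_2^m\overline{p(1/\bar z_1,1/\bar z_2)}$; $p$ is semi-stable if it has no zeros in $\mathbb{D}^2$ and $p,\tilde p$ have no common factor. $\mathcal{I}_p=\{q\in\mathbb{C}[z_1,z_2]:q/p\in L^2(\mathbb{T}^2)\}$. For $\lambda\in\mathbb{T}^2$ and $c>1$, $\Gamma_c(\lambda)$ is the set of $z\in\mathbb{D}^2$ for which any two of $|z_1-\lambda_1|,|z_2-\lambda_2|,1-|z_1|,1-|z_2|$ have ratio in $[1/c,c]$; $f$ is non-tangentially bounded at $\lambda$ if for every $c>1$, $f$ is bounded on $\Gamma_c(\lambda)$ near $\lambda$. Vanishing to order $M$ at a point means the lowest nonzero homogeneous term of the Taylor expansion there has degree $M$. *)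

theory Defs
  imports "HOL-Analysis.Analysis" "HOL-Computational_Algebra.Polynomial_Factorial"
begin

text \<open>Bivariate polynomials in C[z1,z2] are represented as elements of
  complex poly poly: the outer variable is z2, the coefficients are
  polynomials in z1. The coefficient of z1^j z2^k of p is coeff (coeff p k) j.\<close>

definition eval2 :: "complex poly poly \<Rightarrow> complex \<times> complex \<Rightarrow> complex" where
  "eval2 p z = poly (map_poly (\<lambda>a. poly a (fst z)) p) (snd z)"

definition deg1 :: "complex poly poly \<Rightarrow> nat" where
  "deg1 p = Max (insert 0 ((\<lambda>k. degree (coeff p k)) ` {..degree p}))"

definition deg2 :: "complex poly poly \<Rightarrow> nat" where
  "deg2 p = degree p"

text \<open>Reflection: ptilde(z) = z1^n z2^m conj(p(1/conj z1, 1/conj z2)),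
  i.e. coefficient of z1^j z2^k is conj of the coefficient of z1^(n-j) z2^(m-k).\<close>
definition refl2 :: "complex poly poly \<Rightarrow> complex poly poly" where
  "refl2 p = (\<Sum>k\<le>deg2 p. monom (\<Sum>j\<le>deg1 p.
      monom (cnj (coeff (coeff p (deg2 p - k)) (deg1 p - j))) j) k)"

definition disk2 :: "(complex \<times> complex) set" where
  "disk2 = {z. norm (fst z) < 1 \<and> norm (snd z) < 1}"

definition torus2 :: "(complex \<times> complex) set" where
  "torus2 = {z. norm (fst z) = 1 \<and> norm (snd z) = 1}"

definition semi_stable :: "complex poly poly \<Rightarrow> bool" where
  "semi_stable p \<longleftrightarrow> (\<forall>z\<in>disk2. eval2 p z \<noteq> 0)
     \<and> (\<forall>d. d dvd p \<and> d dvd refl2 p \<longrightarrow> is_unit d)"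

definition Ip :: "complex poly poly \<Rightarrow> complex poly poly set" where
  "Ip p = {q. (\<integral>\<^sup>+ x \<in> {0..2*pi} \<times> {0..2*pi}.
       ennreal ((cmod (eval2 q (cis (fst x), cis (snd x)) / eval2 p (cis (fst x), cis (snd x))))\<^sup>2)
       \<partial>(lborel :: (real \<times> real) measure)) < \<infinity>}"

definition Gamma :: "real \<Rightarrow> complex \<times> complex \<Rightarrow> (complex \<times> complex) set" where
  "Gamma c l = {z\<in>disk2. let a = [cmod (fst z - fst l), cmod (snd z - snd l),
                                   1 - cmod (fst z), 1 - cmod (snd z)]
      in \<forall>i<4. \<forall>j<4. a ! i \<le> c * a ! j}"

definition nt_bounded :: "(complex \<times> complex \<Rightarrow> complex) \<Rightarrow> complex \<times> complex \<Rightarrow> bool" where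
  "nt_bounded f l \<longleftrightarrow> (\<forall>c>1. \<exists>\<delta>>0. \<exists>B. \<forall>z\<in>Gamma c l. dist z l < \<delta> \<longrightarrow> cmod (f z) \<le> B)"

definition shift2 :: "complex poly poly \<Rightarrow> complex \<times> complex \<Rightarrow> complex poly poly" where
  "shift2 p l = pcompose (map_poly (\<lambda>a. pcompose a [:fst l, 1:]) p) [:[:snd l:], 1:]"

definition taylor_coeff :: "complex poly poly \<Rightarrow> complex \<times> complex \<Rightarrow> nat \<Rightarrow> nat \<Rightarrow> complex" where
  "taylor_coeff p l j k = coeff (coeff (shift2 p l) k) j"

definition vanishes_order_ge :: "complex poly poly \<Rightarrow> complex \<times> complex \<Rightarrow> nat \<Rightarrow> bool" where
  "vanishes_order_ge p l M \<longleftrightarrow> (\<forall>j k. j + k < M \<longrightarrow> taylor_coeff p l j k = 0)"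

definition vanishes_order :: "complex poly poly \<Rightarrow> complex \<times> complex \<Rightarrow> nat \<Rightarrow> bool" where
  "vanishes_order p l M \<longleftrightarrow> vanishes_order_ge p l M \<and>
     (\<exists>j k. j + k = M \<and> taylor_coeff p l j k \<noteq> 0)"

end

theory Submission
  imports Defs "HOL-Computational_Algebra.Fundamental_Theorem_Algebra"
begin

text \<open>Suppose \<open>p\<close> and \<open>q\<close> vanish at \<open>l\<close> to the orders \<open>M\<close> and \<open>N < M\<close>. In a sector of the
  torus at \<open>l\<close> on which neither lowest-order term vanishes, \<open>q/p\<close> at distance about \<open>r\<close> from \<open>l\<close>
  is at least of size \<open>r\<^sup>N / r\<^sup>M \<ge> 1 / r\<close>. As the torus has real dimension two, each dyadic scale
  contributes at least a fixed amount to the integral of \<open>|q/p|\<^sup>2\<close>, which is therefore infinite.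

  For the non-tangential bound, \<open>q(z) = O(|z - l|\<^sup>M)\<close>, so \<open>p\<close> must be bounded below by a multiple
  of \<open>|z - l|\<^sup>M\<close>. Every root \<open>a\<close> of a one-variable polynomial without zeros in the disk has
  \<open>|z - a| \<ge> 1 - |z|\<close>, hence \<open>|w - a| \<le> (1 + |w - z| / (1 - |z|)) |z - a|\<close>: the values at two points
  of comparable position are comparable. Applied in each variable separately, this compares
  \<open>p(z)\<close> with the value of \<open>p\<close> at a point approaching \<open>l\<close> along a fixed ray on which the
  lowest-order term of \<open>p\<close> does not vanish.\<close>

section \<open>Evaluation, slices and translation of bivariate polynomials\<close>

lemma eval2_0 [simp]: "eval2 0 z = 0"
  by (simp add: eval2_def)

lemma eval2_pCons [simp]: "eval2 (pCons a p) z = poly a (fst z) + snd z * eval2 p z"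
  by (simp add: eval2_def map_poly_pCons)

text \<open>The definition of \<open>eval2\<close> freezes the first variable first. This form
  freezes the second, so that the slice \<open>poly p [:y:]\<close> is available as a one-variable
  polynomial.\<close>

lemma eval2_eq_poly_poly: "eval2 p z = poly (poly p [:snd z:]) (fst z)"
  by (induction p) auto

lemma eval2_shift2: "eval2 (shift2 p l) z = eval2 p (l + z)"
proof -
  have "poly (poly (map_poly (\<lambda>a. pcompose a [:fst l, 1:]) p) [:y:]) x
      = poly (poly p [:y:]) (fst l + x)" for x y
    by (induction p) (auto simp: map_poly_pCons poly_pcompose)
  then show ?thesis
    by (simp add: eval2_eq_poly_poly shift2_def poly_pcompose)
qed

lemma poly_eq_sum_atMost:
  fixes p :: "'a :: comm_semiring_1 poly"
  assumes "degree p \<le> D"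
  shows "poly p x = (\<Sum>i\<le>D. coeff p i * x ^ i)"
  unfolding poly_altdef
  by (rule sum.mono_neutral_left) (use assms in \<open>auto simp: coeff_eq_0\<close>)

lemma degree_coeff_le_deg1: "degree (coeff p k) \<le> deg1 p"
proof (cases "k \<le> degree p")
  case True
  then show ?thesis unfolding deg1_def by (intro Max_ge) auto
next
  case False
  then show ?thesis by (simp add: coeff_eq_0)
qed

lemma eval2_eq_sum:
  assumes "degree p \<le> D" "deg1 p \<le> D"
  shows "eval2 p z = (\<Sum>(k,j)\<in>{..D} \<times> {..D}. coeff (coeff p k) j * fst z ^ j * snd z ^ k)"
proof -
  have "eval2 p z = (\<Sum>k\<le>D. poly (coeff p k) (fst z) * snd z ^ k)"
    unfolding eval2_def
    by (subst poly_eq_sum_atMost[of _ D])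
       (use assms(1) map_poly_degree_leq[of "\<lambda>a. poly a (fst z)" p] in \<open>auto simp: coeff_map_poly\<close>)
  also have "\<dots> = (\<Sum>k\<le>D. \<Sum>j\<le>D. coeff (coeff p k) j * fst z ^ j * snd z ^ k)"
    using order_trans[OF degree_coeff_le_deg1 assms(2)]
    by (intro sum.cong refl) (simp add: poly_eq_sum_atMost[where D = D] sum_distrib_right)
  finally show ?thesis by (simp add: sum.cartesian_product)
qed

section \<open>Rescaling at a point and the lowest-order homogeneous term\<close>

text \<open>A Taylor monomial of degree \<open>j + k\<close> scales by \<open>r ^ (j + k)\<close>.
  Taking out \<open>r ^ M\<close> leaves a polynomial in \<open>(r, x, y)\<close>, hence a function
  still continuous at \<open>r = 0\<close>, where it equals the homogeneous part of degree
  \<open>M\<close>.\<close>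

lemma vanishes_order_ge_rescale:
  assumes "vanishes_order_ge p l M"
  obtains G :: "complex \<times> complex \<times> complex \<Rightarrow> complex" where
    "continuous_on UNIV G"
    "\<And>r x y. eval2 p (l + (r * x, r * y)) = r ^ M * G (r, x, y)"
    "\<And>x y. G (0, x, y) = (\<Sum>k\<le>M. taylor_coeff p l (M - k) k * x ^ (M - k) * y ^ k)"
proof
  define s where "s = shift2 p l"
  \<comment> \<open>Large enough to cover all monomials of \<open>s\<close> and also every pair with
    \<open>j + k = M\<close>.\<close>
  define D where "D = degree s + deg1 s + M"
  define c where "c j k = taylor_coeff p l j k" for j k
  define G :: "complex \<times> complex \<times> complex \<Rightarrow> complex" where
    "G = (\<lambda>w. \<Sum>(k,j)\<in>{..D} \<times> {..D}. c j k * fst w ^ (j + k - M) * fst (snd w) ^ j * snd (snd w) ^ k)"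
  have c0: "c j k = 0" if "j + k < M" for j k
    using assms that by (auto simp: vanishes_order_ge_def c_def)
  show "continuous_on UNIV G"
    unfolding G_def case_prod_unfold by (intro continuous_intros)
  show "eval2 p (l + (r * x, r * y)) = r ^ M * G (r, x, y)" for r x y
  proof -
    have eq: "c j k * (r * x) ^ j * (r * y) ^ k = r ^ M * (c j k * r ^ (j + k - M) * x ^ j * y ^ k)" for j k
    proof (cases "j + k < M")
      case False
      then have "r ^ j * r ^ k = r ^ M * r ^ (j + k - M)"
        by (simp flip: power_add)
      then show ?thesis by (simp add: power_mult_distrib)
    qed (simp add: c0)
    have "eval2 p (l + (r * x, r * y)) = eval2 s (r * x, r * y)"
      by (simp add: s_def eval2_shift2)
    also have "\<dots> = (\<Sum>(k,j)\<in>{..D} \<times> {..D}. c j k * (r * x) ^ j * (r * y) ^ k)"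
      by (subst eval2_eq_sum[of _ D]) (simp_all add: D_def c_def taylor_coeff_def s_def)
    also have "\<dots> = r ^ M * G (r, x, y)"
      unfolding eq by (simp add: G_def sum_distrib_left case_prod_unfold)
    finally show ?thesis .
  qed
  show "G (0, x, y) = (\<Sum>k\<le>M. taylor_coeff p l (M - k) k * x ^ (M - k) * y ^ k)" for x y
  proof -
    have "G (0, x, y) = (\<Sum>(k,j)\<in>{..D} \<times> {..D}. c j k * 0 ^ (j + k - M) * x ^ j * y ^ k)"
      by (simp add: G_def)
    \<comment> \<open>With truncated subtraction \<open>0 ^ (j + k - M)\<close> is 1 also for
      \<open>j + k < M\<close>, but there the coefficient is 0; only \<open>j + k = M\<close>
      survives.\<close>
    also have "\<dots> = (\<Sum>(k,j)\<in>(\<lambda>k. (k, M - k)) ` {..M}. c j k * x ^ j * y ^ k)"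
      by (intro sum.mono_neutral_cong_right)
         (auto simp: D_def image_iff power_0_left c0 not_less)
    also have "\<dots> = (\<Sum>k\<le>M. c (M - k) k * x ^ (M - k) * y ^ k)"
      by (subst sum.reindex) (auto intro: inj_onI)
    finally show ?thesis by (simp add: c_def)
  qed
qed

text \<open>On the directions \<open>(\<alpha>, \<beta> * s)\<close> the lowest-order term is a
  polynomial in \<open>s\<close> with a nonzero coefficient at \<open>k0\<close>. All but finitely
  many \<open>s\<close> are therefore good directions, which also allows one direction to serve two
  polynomials.\<close>

lemma vanishes_order_rescale:
  assumes "vanishes_order p l M"
  obtains G :: "complex \<times> complex \<times> complex \<Rightarrow> complex" where
    "continuous_on UNIV G"
    "\<And>r x y. eval2 p (l + (r * x, r * y)) = r ^ M * G (r, x, y)"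
    "\<And>\<alpha> \<beta>. \<alpha> \<noteq> 0 \<Longrightarrow> \<beta> \<noteq> 0 \<Longrightarrow> finite {s. G (0, \<alpha>, \<beta> * s) = 0}"
proof -
  from assms have ge: "vanishes_order_ge p l M"
    by (simp add: vanishes_order_def)
  from assms obtain j0 k0 where "j0 + k0 = M" "taylor_coeff p l j0 k0 \<noteq> 0"
    by (auto simp: vanishes_order_def)
  then have k0: "k0 \<le> M" "taylor_coeff p l (M - k0) k0 \<noteq> 0"
    by auto
  obtain G :: "complex \<times> complex \<times> complex \<Rightarrow> complex" where G: "continuous_on UNIV G"
    "\<And>r x y. eval2 p (l + (r * x, r * y)) = r ^ M * G (r, x, y)"
    "\<And>x y. G (0, x, y) = (\<Sum>k\<le>M. taylor_coeff p l (M - k) k * x ^ (M - k) * y ^ k)"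
    by (rule vanishes_order_ge_rescale[OF ge]) (rule that; assumption)
  have "finite {s. G (0, \<alpha>, \<beta> * s) = 0}" if "\<alpha> \<noteq> 0" "\<beta> \<noteq> 0" for \<alpha> \<beta>
  proof -
    define h where "h = (\<Sum>k\<le>M. monom (taylor_coeff p l (M - k) k * \<alpha> ^ (M - k) * \<beta> ^ k) k)"
    have "coeff h k0 = taylor_coeff p l (M - k0) k0 * \<alpha> ^ (M - k0) * \<beta> ^ k0"
      using k0(1) by (simp add: h_def coeff_sum)
    then have "coeff h k0 \<noteq> 0" using k0 that by simp
    then have "h \<noteq> 0" by auto
    moreover have "G (0, \<alpha>, \<beta> * s) = poly h s" for s
      by (simp add: G(3) h_def poly_sum poly_monom power_mult_distrib mult_ac)
    ultimately show ?thesis by (simp add: poly_roots_finite)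
  qed
  with G(1,2) that show thesis by blast
qed

lemma ex_pos_real_notin_finite:
  fixes A :: "complex set"
  assumes "finite A"
  obtains s :: real where "s > 0" "of_real s \<notin> A"
proof -
  have "infinite (complex_of_real ` {0<..})"
    by (simp add: finite_image_iff inj_on_def infinite_Ioi)
  then have "\<not> complex_of_real ` {0<..} \<subseteq> A"
    using assms finite_subset by blast
  then show thesis using that by auto
qed

lemma ex_vanishes_order_less:
  assumes "\<not> vanishes_order_ge p l M"
  obtains N where "N < M" "vanishes_order p l N"
proof -
  define P where "P N \<longleftrightarrow> (\<exists>j k. j + k = N \<and> taylor_coeff p l j k \<noteq> 0)" for N
  from assms obtain N0 where N0: "P N0" "N0 < M"
    by (auto simp: vanishes_order_ge_def P_def)
  have "P (LEAST N. P N)" using N0(1) by (rule LeastI)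
  moreover have "vanishes_order_ge p l (LEAST N. P N)"
    unfolding vanishes_order_ge_def
  proof (intro allI impI)
    fix j k assume "j + k < (LEAST N. P N)"
    then have "\<not> P (j + k)" by (rule not_less_Least)
    then show "taylor_coeff p l j k = 0" by (auto simp: P_def)
  qed
  moreover have "(LEAST N. P N) < M"
    using Least_le[of P, OF N0(1)] N0(2) by simp
  ultimately show thesis
    by (intro that[of "LEAST N. P N"]) (simp_all add: vanishes_order_def P_def)
qed

lemma ex_vanishes_order:
  assumes "eval2 p z \<noteq> 0"
  obtains M where "vanishes_order p l M"
proof -
  have "eval2 (shift2 p l) (z - l) \<noteq> 0" using assms by (simp add: eval2_shift2)
  then have "shift2 p l \<noteq> 0" by auto
  then obtain j k where "coeff (coeff (shift2 p l) k) j \<noteq> 0"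
    by (metis leading_coeff_neq_0)
  then have "\<not> vanishes_order_ge p l (Suc (j + k))"
    by (auto simp: vanishes_order_ge_def taylor_coeff_def)
  then show thesis using ex_vanishes_order_less that by blast
qed

section \<open>Harnack-type comparison for polynomials without zeros in the disk\<close>

text \<open>Induction on the degree bound, splitting off one root at a time: each linear factor
  costs at most a factor \<open>K\<close>. A bound \<open>n\<close> replaces the exact degree
  because the degrees of the slices of a bivariate polynomial vary.\<close>

lemma zero_free_poly_harnack:
  fixes p :: "complex poly"
  assumes "\<And>a. cmod a < 1 \<Longrightarrow> poly p a \<noteq> 0" and "cmod z < 1"
    and "cmod (w - z) \<le> (K - 1) * (1 - cmod z)" and "degree p \<le> n"
  shows "cmod (poly p w) \<le> K ^ n * cmod (poly p z)"
  using assms(1,4)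
proof (induction n arbitrary: p)
  case 0
  then obtain c where "p = [:c:]" by (auto elim: degree_eq_zeroE)
  then show ?case by simp
next
  case (Suc n)
  have "0 \<le> (K - 1) * (1 - cmod z)" using assms(3) norm_ge_zero order_trans by blast
  then have K: "K \<ge> 1" using assms(2) by (simp add: zero_le_mult_iff)
  show ?case
  proof (cases "degree p = 0")
    case True
    then obtain c where "p = [:c:]" by (auto elim: degree_eq_zeroE)
    moreover have "1 * cmod c \<le> K ^ Suc n * cmod c"
      by (intro mult_right_mono one_le_power K) simp
    ultimately show ?thesis by simp
  next
    case False
    then obtain a where a: "poly p a = 0"
      using fundamental_theorem_of_algebra[of p] by (auto simp: constant_degree)
    then obtain r where r: "p = [:-a, 1:] * r" by (auto simp: poly_eq_0_iff_dvd)
    with False have "r \<noteq> 0" by auto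
    then have "degree p = Suc (degree r)" unfolding r by (subst degree_mult_eq) auto
    then have IH: "cmod (poly r w) \<le> K ^ n * cmod (poly r z)"
      using Suc.prems by (intro Suc.IH) (auto simp: r)
    have "cmod a \<ge> 1" using a Suc.prems(1) not_less by blast
    then have "1 - cmod z \<le> cmod (z - a)"
      using norm_triangle_ineq2[of a z] by (simp add: norm_minus_commute)
    then have "(K - 1) * (1 - cmod z) \<le> (K - 1) * cmod (z - a)"
      using K by (intro mult_left_mono) auto
    then have "cmod (w - a) \<le> K * cmod (z - a)"
      using norm_triangle_ineq[of "w - z" "z - a"] assms(3) by (simp add: algebra_simps)
    then have "cmod (w - a) * cmod (poly r w) \<le> (K * cmod (z - a)) * (K ^ n * cmod (poly r z))"
      using IH K by (intro mult_mono) auto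
    moreover have "poly p x = (x - a) * poly r x" for x by (simp add: r algebra_simps)
    ultimately show ?thesis by (simp add: norm_mult mult_ac)
  qed
qed

text \<open>The path from \<open>w\<close> to \<open>z\<close> passes through
  \<open>(fst z, snd w)\<close>, changing one coordinate at a time. The condition on
  \<open>snd w\<close> makes the first slice, with second coordinate \<open>snd w\<close>, free of
  zeros in the disk.\<close>

lemma zero_free_eval2_harnack:
  assumes nz: "\<And>z. z \<in> disk2 \<Longrightarrow> eval2 p z \<noteq> 0"
    and "z \<in> disk2" "cmod (snd w) < 1"
    and 1: "cmod (fst w - fst z) \<le> (K - 1) * (1 - cmod (fst z))"
    and 2: "cmod (snd w - snd z) \<le> (K - 1) * (1 - cmod (snd z))"
  shows "cmod (eval2 p w) \<le> K ^ (deg1 p + degree p) * cmod (eval2 p z)"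
proof -
  have z: "cmod (fst z) < 1" "cmod (snd z) < 1" using assms(2) by (auto simp: disk2_def)
  have "0 \<le> (K - 1) * (1 - cmod (fst z))" using 1 norm_ge_zero order_trans by blast
  then have K: "K \<ge> 1" using z by (simp add: zero_le_mult_iff)
  have "degree (poly p [:y:]) \<le> deg1 p" for y
  proof -
    have "poly p [:y:] = (\<Sum>k\<le>degree p. smult (y ^ k) (coeff p k))"
      by (simp add: poly_altdef poly_const_pow)
    also have "degree \<dots> \<le> deg1 p"
      by (intro degree_sum_le) (auto simp: degree_coeff_le_deg1)
    finally show ?thesis .
  qed
  then have "cmod (eval2 p w) \<le> K ^ deg1 p * cmod (eval2 p (fst z, snd w))"
    using z nz assms(3) 1
    unfolding eval2_eq_poly_poly[of _ w] eval2_eq_poly_poly[of _ "(fst z, snd w)"] fst_conv snd_conv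
    by (intro zero_free_poly_harnack) (auto simp: eval2_eq_poly_poly disk2_def)
  also have "cmod (eval2 p (fst z, snd w)) \<le> K ^ degree p * cmod (eval2 p z)"
    using z nz assms(3) 2 unfolding eval2_def fst_conv snd_conv
    by (intro zero_free_poly_harnack map_poly_degree_leq) (auto simp: eval2_def disk2_def)
  finally show ?thesis using K by (simp add: power_add mult_left_mono mult.assoc)
qed

section \<open>Divergence of square integrals on the torus\<close>

text \<open>By disjointness the step function with value \<open>a n\<close> on \<open>B n\<close>
  lies below \<open>f\<close>, and its integral is an infinite sum of terms at least
  \<open>\<kappa>\<close>.\<close>

lemma nn_integral_eq_top_if_disjoint_lower_bounds:
  fixes B :: "nat \<Rightarrow> 'a set" and a :: "nat \<Rightarrow> ennreal"
  assumes "disjoint_family B" "\<And>n. B n \<in> sets M"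
    and "\<And>n x. x \<in> B n \<Longrightarrow> a n \<le> f x"
    and "\<kappa> > 0" "\<And>n. \<kappa> \<le> a n * emeasure M (B n)"
  shows "(\<integral>\<^sup>+ x. f x \<partial>M) = \<infinity>"
proof -
  have "(\<Sum>n. a n * indicator (B n) x) \<le> f x" for x
  proof (cases "\<exists>n. x \<in> B n")
    case True
    then obtain n where "x \<in> B n" by blast
    then show ?thesis using suminf_cmult_indicator[OF assms(1), of x n a] assms(3) by simp
  next
    case False
    then show ?thesis by simp
  qed
  then have "(\<integral>\<^sup>+ x. (\<Sum>n. a n * indicator (B n) x) \<partial>M) \<le> (\<integral>\<^sup>+ x. f x \<partial>M)"
    by (intro nn_integral_mono)
  moreover have "(\<integral>\<^sup>+ x. (\<Sum>n. a n * indicator (B n) x) \<partial>M) = (\<Sum>n. a n * emeasure M (B n))"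
    using assms(2) by (subst nn_integral_suminf) (auto simp: nn_integral_cmult_indicator)
  moreover have "(\<Sum>n. \<kappa>) \<le> (\<Sum>n. a n * emeasure M (B n))"
    using assms(5) by (intro suminf_le) auto
  moreover have "(\<Sum>n. \<kappa>) = \<infinity>"
    using assms(4) by (simp flip: nn_integral_count_space_nat add: ennreal_mult_top)
  ultimately show ?thesis by (simp add: top_unique)
qed

text \<open>The strict bound \<open>t < 2 * pi\<close> leaves room to the right of \<open>t\<close>
  in the interval of integration, where the boxes of the divergence argument will lie.\<close>

lemma ex_cis_eq:
  assumes "cmod z = 1"
  obtains t where "0 \<le> t" "t < 2 * pi" "z = cis t"
proof
  show "0 \<le> Arg2pi z" "Arg2pi z < 2 * pi" by (rule Arg2pi_ge_0, rule Arg2pi_lt_2pi)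
  show "z = cis (Arg2pi z)"
    by (subst Arg2pi_eq[of z]) (simp only: assms cis_conv_exp of_real_1 mult_1)
qed

text \<open>The difference quotient of \<open>exp\<close> at 0 with its removable singularity filled
  in. It puts a torus point \<open>cis (t + r * u)\<close> into the rescaled form
  \<open>cis t + r * x\<close> with \<open>x\<close> continuous at \<open>r = 0\<close>.\<close>

definition exp_quot :: "complex \<Rightarrow> complex" where
  "exp_quot w = (if w = 0 then 1 else (exp w - 1) / w)"

lemma exp_eq_exp_quot: "exp w = 1 + w * exp_quot w"
  by (simp add: exp_quot_def)

lemma isCont_exp_quot_0: "isCont exp_quot 0"
proof -
  have "((\<lambda>h. (exp (0 + h) - exp 0) / h) \<longlongrightarrow> exp 0) (at (0::complex))"
    using DERIV_exp[of "0::complex"] unfolding DERIV_def .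
  then have "((\<lambda>h. (exp h - 1) / h) \<longlongrightarrow> 1) (at (0::complex))" by simp
  then have "(exp_quot \<longlongrightarrow> 1) (at 0)"
    by (rule Lim_transform_eventually) (auto simp: eventually_at_filter exp_quot_def)
  then show ?thesis by (simp add: isCont_def exp_quot_def)
qed

lemma isCont_imp_eventually_norm_greater:
  fixes f :: "'a::t2_space \<Rightarrow> 'b::real_normed_vector"
  assumes "isCont f a" "m < norm (f a)"
  shows "\<forall>\<^sub>F x in nhds a. m < norm (f x)"
proof -
  have "(f \<longlongrightarrow> f a) (nhds a)"
    using assms(1) unfolding isCont_def tendsto_at_iff_tendsto_nhds .
  then show ?thesis using assms(2) by (intro order_tendstoD(1)[OF tendsto_norm])
qed

text \<open>The box at scale \<open>r n\<close> has area \<open>(r n * \<eta>)\<^sup>2\<close>,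
  while the squared modulus is at least \<open>(\<kappa> / r n)\<^sup>2\<close> on it. The product
  \<open>\<kappa>\<^sup>2 * \<eta>\<^sup>2\<close> is the same at every scale.\<close>

lemma square_integral_eq_top:
  fixes f :: "complex \<times> complex \<Rightarrow> complex"
  assumes \<theta>: "0 \<le> \<theta>1" "\<theta>1 < 2 * pi" "0 \<le> \<theta>2" "\<theta>2 < 2 * pi"
    and "s > 0" "\<epsilon> > 0" "\<kappa> > 0"
    and f: "\<And>r a b. 0 < r \<Longrightarrow> r < \<epsilon> \<Longrightarrow> \<bar>a - 1\<bar> < \<epsilon> \<Longrightarrow> \<bar>b - s\<bar> < \<epsilon> \<Longrightarrow>
        \<kappa> / r \<le> cmod (f (cis (\<theta>1 + r * a), cis (\<theta>2 + r * b)))"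
  shows "(\<integral>\<^sup>+ x \<in> {0..2*pi} \<times> {0..2*pi}. ennreal ((cmod (f (cis (fst x), cis (snd x))))\<^sup>2)
      \<partial>(lborel :: (real \<times> real) measure)) = \<infinity>"
proof -
  define \<eta> where "\<eta> = min (\<epsilon> / 2) (1 / 2)"
  \<comment> \<open>The last two bounds keep all boxes inside the square of integration, since
    \<open>1 + \<eta> \<le> 2\<close> and \<open>s + \<eta> \<le> s + 1\<close>.\<close>
  define \<delta> where "\<delta> = min (\<epsilon> / 2) (min ((2 * pi - \<theta>1) / 2) ((2 * pi - \<theta>2) / (s + 1)))"
  define r where "r n = \<delta> / 2 ^ n" for n :: nat
  define B where "B n = {\<theta>1 + r n..\<theta>1 + r n * (1 + \<eta>)} \<times> {\<theta>2 + r n * s..\<theta>2 + r n * (s + \<eta>)}" for n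
  have \<eta>: "0 < \<eta>" "\<eta> < \<epsilon>" "\<eta> < 1" using \<open>\<epsilon> > 0\<close> by (auto simp: \<eta>_def)
  have \<delta>: "0 < \<delta>" "\<delta> < \<epsilon>"
    using \<theta> \<open>\<epsilon> > 0\<close> \<open>s > 0\<close> unfolding \<delta>_def by auto
  have "\<delta> \<le> (2 * pi - \<theta>1) / 2" "\<delta> \<le> (2 * pi - \<theta>2) / (s + 1)"
    unfolding \<delta>_def by linarith+
  then have \<delta>2: "\<delta> * 2 \<le> 2 * pi - \<theta>1" "\<delta> * (s + 1) \<le> 2 * pi - \<theta>2"
    using \<open>s > 0\<close> by (simp_all add: pos_le_divide_eq)
  have r: "0 < r n" "r n \<le> \<delta>" for n
  proof -
    have "\<delta> * 1 \<le> \<delta> * 2 ^ n" using \<delta>(1) by (intro mult_left_mono) auto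
    then show "r n \<le> \<delta>" by (simp add: r_def pos_divide_le_eq)
    show "0 < r n" using \<delta>(1) by (simp add: r_def)
  qed
  \<comment> \<open>As \<open>\<eta> < 1\<close> and the scales halve, boxes of different scales are
    already disjoint in the first coordinate.\<close>
  have r_less: "r n * (1 + \<eta>) < r m" if "m < n" for m n
  proof -
    have "r n * 2 \<le> r m"
    proof -
      have "(2::real) ^ Suc m \<le> 2 ^ n" using that by (intro power_increasing) auto
      then show ?thesis using \<delta>(1) by (simp add: r_def field_simps)
    qed
    moreover have "r n * (1 + \<eta>) < r n * 2" using r[of n] \<eta> by simp
    ultimately show ?thesis by linarith
  qed
  show ?thesis
  proof (rule nn_integral_eq_top_if_disjoint_lower_bounds)
    show "disjoint_family B"
      unfolding disjoint_family_on_def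
    proof (intro ballI impI)
      have *: "B m \<inter> B n = {}" if "m < n" for m n
        using r_less[OF that] by (auto simp: B_def)
      show "B m \<inter> B n = {}" if "m \<noteq> n" for m n
        using *[of m n] *[of n m] that by (cases m n rule: linorder_cases) auto
    qed
    show "B n \<in> sets lborel" for n
      by (auto simp: B_def intro!: borel_closed closed_Times)
    show "ennreal ((\<kappa> / r n)\<^sup>2) \<le> ennreal ((cmod (f (cis (fst x), cis (snd x))))\<^sup>2) *
        indicator ({0..2*pi} \<times> {0..2*pi}) x" if "x \<in> B n" for n x
    proof -
      obtain h k where x: "x = (h, k)" by (cases x)
      define a where "a = (h - \<theta>1) / r n"
      define b where "b = (k - \<theta>2) / r n"
      have hk: "h = \<theta>1 + r n * a" "k = \<theta>2 + r n * b" using r[of n] by (auto simp: a_def b_def)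
      have ab: "1 \<le> a" "a \<le> 1 + \<eta>" "s \<le> b" "b \<le> s + \<eta>"
        using that r[of n] by (auto simp: B_def x hk)
      have "r n * a \<le> \<delta> * 2" "r n * b \<le> \<delta> * (s + 1)"
        using r[of n] ab \<eta> \<open>s > 0\<close> by (intro mult_mono; linarith)+
      moreover have "0 \<le> r n * a" "0 \<le> r n * b" using r[of n] ab \<open>s > 0\<close> by auto
      ultimately have "x \<in> {0..2*pi} \<times> {0..2*pi}"
        using \<theta> \<delta>2 by (simp add: x hk)
      moreover have "\<kappa> / r n \<le> cmod (f (cis h, cis k))"
        unfolding hk using r[of n] ab \<eta> \<delta> by (intro f) auto
      then have "(\<kappa> / r n)\<^sup>2 \<le> (cmod (f (cis h, cis k)))\<^sup>2"
        using \<open>\<kappa> > 0\<close> r[of n] by (intro power_mono) auto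
      ultimately show ?thesis by (simp add: x ennreal_leI)
    qed
    show "ennreal (\<kappa>\<^sup>2 * \<eta>\<^sup>2) > 0" using \<open>\<kappa> > 0\<close> \<eta> by simp
    show "ennreal (\<kappa>\<^sup>2 * \<eta>\<^sup>2) \<le> ennreal ((\<kappa> / r n)\<^sup>2) * emeasure lborel (B n)" for n
    proof -
      have le: "r n \<le> r n * (1 + \<eta>)" "r n * s \<le> r n * (s + \<eta>)"
        using r[of n] \<eta> by auto
      have "emeasure lborel (B n) = ennreal (r n * \<eta>) * ennreal (r n * \<eta>)"
        unfolding B_def lborel_prod[symmetric] using le
        by (subst lborel.emeasure_pair_measure_Times) (auto simp: algebra_simps)
      also have "\<dots> = ennreal ((r n * \<eta>)\<^sup>2)"
        using r[of n] \<eta> by (simp add: ennreal_mult[symmetric] power2_eq_square)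
      finally have "ennreal ((\<kappa> / r n)\<^sup>2) * emeasure lborel (B n) = ennreal ((\<kappa> / r n)\<^sup>2 * (r n * \<eta>)\<^sup>2)"
        by (simp add: ennreal_mult)
      also have "(\<kappa> / r n)\<^sup>2 * (r n * \<eta>)\<^sup>2 = \<kappa>\<^sup>2 * \<eta>\<^sup>2"
        using r[of n] by (simp add: field_simps)
      finally show ?thesis by simp
    qed
  qed
qed

section \<open>Vanishing order of the elements of \<open>Ip p\<close>\<close>

lemma Ip_vanishes_order_ge:
  assumes l: "l \<in> torus2" and q: "q \<in> Ip p" and p: "vanishes_order p l M"
  shows "vanishes_order_ge q l M"
proof (rule ccontr)
  assume "\<not> vanishes_order_ge q l M"
  then obtain N where "N < M" "vanishes_order q l N"
    by (rule ex_vanishes_order_less)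
  obtain Gp where Gp: "continuous_on UNIV Gp"
      "\<And>r x y. eval2 p (l + (r * x, r * y)) = r ^ M * Gp (r, x, y)"
      "\<And>\<alpha> \<beta>. \<alpha> \<noteq> 0 \<Longrightarrow> \<beta> \<noteq> 0 \<Longrightarrow> finite {s. Gp (0, \<alpha>, \<beta> * s) = 0}"
    by (rule vanishes_order_rescale[OF p]) (rule that; assumption)
  obtain Gq where Gq: "continuous_on UNIV Gq"
      "\<And>r x y. eval2 q (l + (r * x, r * y)) = r ^ N * Gq (r, x, y)"
      "\<And>\<alpha> \<beta>. \<alpha> \<noteq> 0 \<Longrightarrow> \<beta> \<noteq> 0 \<Longrightarrow> finite {s. Gq (0, \<alpha>, \<beta> * s) = 0}"
    by (rule vanishes_order_rescale[OF \<open>vanishes_order q l N\<close>]) (rule that; assumption)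
  obtain l1 l2 where l12: "l = (l1, l2)" "cmod l1 = 1" "cmod l2 = 1"
    using l by (cases l) (auto simp: torus2_def)
  then have [simp]: "l1 \<noteq> 0" "l2 \<noteq> 0" by auto
  obtain \<theta>1 where \<theta>1: "0 \<le> \<theta>1" "\<theta>1 < 2 * pi" "l1 = cis \<theta>1" using ex_cis_eq l12(2) .
  obtain \<theta>2 where \<theta>2: "0 \<le> \<theta>2" "\<theta>2 < 2 * pi" "l2 = cis \<theta>2" using ex_cis_eq l12(3) .
  \<comment> \<open>\<open>(\<i> * l1, \<i> * l2 * s)\<close> is tangent to the torus at
    \<open>l\<close>; one \<open>s\<close> avoids the zeros of both lowest-order terms.\<close>
  obtain s :: real where "s > 0"
    and "of_real s \<notin> {s. Gp (0, \<i> * l1, \<i> * l2 * s) = 0} \<union> {s. Gq (0, \<i> * l1, \<i> * l2 * s) = 0}"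
    by (rule ex_pos_real_notin_finite
        [OF finite_UnI[OF Gp(3)[of "\<i> * l1" "\<i> * l2"] Gq(3)[of "\<i> * l1" "\<i> * l2"]]]) auto
  then have nz: "Gp (0, \<i> * l1, \<i> * l2 * s) \<noteq> 0" "Gq (0, \<i> * l1, \<i> * l2 * s) \<noteq> 0" by auto
  \<comment> \<open>\<open>\<Phi> (r, a, b) = (r, x, y)\<close> holds the rescaled coordinates of
    the torus point with angles \<open>\<theta>1 + r * a\<close> and
    \<open>\<theta>2 + r * b\<close>. There \<open>q/p\<close> is \<open>r ^ N / r ^ M\<close> times
    \<open>F\<close>, and \<open>F\<close> is continuous and nonzero at
    \<open>(0, 1, s)\<close>.\<close>
  define \<Phi> where "\<Phi> w = (complex_of_real (fst w),
      \<i> * l1 * of_real (fst (snd w)) * exp_quot (\<i> * of_real (fst w * fst (snd w))),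
      \<i> * l2 * of_real (snd (snd w)) * exp_quot (\<i> * of_real (fst w * snd (snd w))))" for w
  define F where "F w = Gq (\<Phi> w) / Gp (\<Phi> w)" for w
  have \<Phi>0: "\<Phi> (0, 1, s) = (0, \<i> * l1, \<i> * l2 * s)" by (simp add: \<Phi>_def exp_quot_def)
  have cont\<Phi>: "isCont \<Phi> (0, 1, s)"
  proof -
    have E: "isCont (\<lambda>w. exp_quot (\<i> * of_real (fst w * g w))) (0, 1, s)"
      if "isCont g (0, 1, s)" for g :: "real \<times> real \<times> real \<Rightarrow> real"
    proof (rule isCont_o2[where g = exp_quot])
      show "isCont (\<lambda>w. \<i> * complex_of_real (fst w * g w)) (0, 1, s)"
        by (intro that continuous_mult continuous_of_real continuous_const
            continuous_fst continuous_ident)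
      show "isCont exp_quot (\<i> * complex_of_real (fst (0, 1, s) * g (0, 1, s)))"
        using isCont_exp_quot_0 by simp
    qed
    have "isCont (\<lambda>w. fst (snd w)) (0::real, 1::real, s)"
        "isCont (\<lambda>w. snd (snd w)) (0::real, 1::real, s)"
      by (intro continuous_fst continuous_snd continuous_ident)+
    note this E[OF this(1)] E[OF this(2)]
    then show ?thesis
      unfolding \<Phi>_def
      by (intro continuous_Pair continuous_mult continuous_of_real continuous_const
          continuous_fst continuous_snd continuous_ident)
  qed
  have "isCont Gp (\<Phi> (0, 1, s))" "isCont Gq (\<Phi> (0, 1, s))"
    using Gp(1) Gq(1) unfolding continuous_on_eq_continuous_at[OF open_UNIV] by blast+
  then have "isCont (\<lambda>w. Gp (\<Phi> w)) (0, 1, s)" "isCont (\<lambda>w. Gq (\<Phi> w)) (0, 1, s)"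
    using isCont_o2[OF cont\<Phi>] by blast+
  then have "isCont F (0, 1, s)"
    unfolding F_def using nz(1) by (intro isCont_divide) (simp_all add: \<Phi>0)
  moreover define \<kappa> where "\<kappa> = cmod (F (0, 1, s)) / 2"
  have "\<kappa> > 0" using nz by (simp add: \<kappa>_def F_def \<Phi>0)
  then have "\<kappa> < cmod (F (0, 1, s))" by (simp add: \<kappa>_def)
  ultimately have "\<forall>\<^sub>F w in nhds (0, 1, s). \<kappa> < cmod (F w)"
    by (rule isCont_imp_eventually_norm_greater)
  then obtain \<delta> where \<delta>: "\<delta> > 0" "\<And>w. dist w (0, 1, s) < \<delta> \<Longrightarrow> \<kappa> < cmod (F w)"
    unfolding eventually_nhds_metric by blast
  \<comment> \<open>One third of \<open>\<delta>\<close> for each of the three coordinates; the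
    bound 1 gives \<open>r < 1\<close>, so that \<open>N < M\<close> yields
    \<open>r ^ M \<le> r ^ Suc N\<close>.\<close>
  define \<epsilon> where "\<epsilon> = min (\<delta> / 3) 1"
  have "(\<integral>\<^sup>+ x \<in> {0..2*pi} \<times> {0..2*pi}.
      ennreal ((cmod ((\<lambda>z. eval2 q z / eval2 p z) (cis (fst x), cis (snd x))))\<^sup>2)
      \<partial>(lborel :: (real \<times> real) measure)) = \<infinity>"
  proof (rule square_integral_eq_top[OF \<theta>1(1,2) \<theta>2(1,2) \<open>s > 0\<close> _ \<open>\<kappa> > 0\<close>])
    show "\<epsilon> > 0" using \<delta>(1) by (simp add: \<epsilon>_def)
    fix r a b :: real
    assume r: "0 < r" "r < \<epsilon>" and a: "\<bar>a - 1\<bar> < \<epsilon>" and b: "\<bar>b - s\<bar> < \<epsilon>"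
    have "dist (r, a, b) (0, 1, s) \<le> \<bar>r\<bar> + (\<bar>a - 1\<bar> + \<bar>b - s\<bar>)"
      unfolding dist_norm using norm_Pair_le[of r "(a - 1, b - s)"] norm_Pair_le[of "a - 1" "b - s"]
      by simp
    also have "\<dots> < \<delta>" using r a b by (simp add: \<epsilon>_def)
    finally have \<kappa>: "\<kappa> < cmod (F (r, a, b))" by (rule \<delta>(2))
    define x y where "x = fst (snd (\<Phi> (r, a, b)))" and "y = snd (snd (\<Phi> (r, a, b)))"
    have \<Phi>: "\<Phi> (r, a, b) = (of_real r, x, y)"
      by (simp add: x_def y_def \<Phi>_def)
    have cis_eq: "cis (t + r * u) =
        cis t + of_real r * (\<i> * cis t * of_real u * exp_quot (\<i> * of_real (r * u)))" for t u
    proof -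
      have "cis (t + r * u) = cis t * exp (\<i> * of_real (r * u))"
        by (simp add: cis_conv_exp distrib_left exp_add)
      then show ?thesis unfolding exp_eq_exp_quot[of "\<i> * of_real (r * u)"]
        by (simp add: algebra_simps)
    qed
    have cis_l: "(cis (\<theta>1 + r * a), cis (\<theta>2 + r * b)) = l + (of_real r * x, of_real r * y)"
      by (simp add: l12(1) \<theta>1(3) \<theta>2(3) x_def y_def \<Phi>_def cis_eq)
    have "eval2 q (cis (\<theta>1 + r * a), cis (\<theta>2 + r * b)) /
        eval2 p (cis (\<theta>1 + r * a), cis (\<theta>2 + r * b)) = of_real r ^ N / of_real r ^ M * F (r, a, b)"
      unfolding F_def \<Phi> cis_l Gp(2) Gq(2) by simp
    moreover have "1 / r \<le> r ^ N / r ^ M"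
    proof -
      have "r ^ M \<le> r ^ Suc N"
        using r \<open>N < M\<close> by (intro power_decreasing) (auto simp: \<epsilon>_def)
      then show ?thesis using r(1) by (simp add: field_simps)
    qed
    then have "1 / r * \<kappa> \<le> r ^ N / r ^ M * cmod (F (r, a, b))"
      using r \<kappa> \<open>\<kappa> > 0\<close> by (intro mult_mono) auto
    ultimately show "\<kappa> / r \<le> cmod (eval2 q (cis (\<theta>1 + r * a), cis (\<theta>2 + r * b)) /
        eval2 p (cis (\<theta>1 + r * a), cis (\<theta>2 + r * b)))"
      using r(1) by (simp add: norm_mult norm_divide norm_power)
  qed
  then show False using q by (simp add: Ip_def)
qed

section \<open>Non-tangential boundedness\<close>

text \<open>On \<open>Gamma c l\<close> all four distances are comparable to
  \<open>t = cmod (z1 - l1)\<close>. After rescaling by \<open>t\<close>, \<open>q\<close> is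
  controlled by compactness, and \<open>p\<close> by its value at a point of scale \<open>t\<close>
  on a fixed ray.\<close>

lemma nt_bounded_divide:
  assumes nz: "\<And>z. z \<in> disk2 \<Longrightarrow> eval2 p z \<noteq> 0" and l: "l \<in> torus2"
    and p: "vanishes_order p l M" and q: "vanishes_order_ge q l M"
  shows "nt_bounded (\<lambda>z. eval2 q z / eval2 p z) l"
  unfolding nt_bounded_def
proof (intro allI impI)
  fix c :: real assume "c > 1"
  obtain Gp where Gp: "continuous_on UNIV Gp"
      "\<And>r x y. eval2 p (l + (r * x, r * y)) = r ^ M * Gp (r, x, y)"
      "\<And>\<alpha> \<beta>. \<alpha> \<noteq> 0 \<Longrightarrow> \<beta> \<noteq> 0 \<Longrightarrow> finite {s. Gp (0, \<alpha>, \<beta> * s) = 0}"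
    by (rule vanishes_order_rescale[OF p]) (rule that; assumption)
  obtain Gq where Gq: "continuous_on UNIV Gq"
      "\<And>r x y. eval2 q (l + (r * x, r * y)) = r ^ M * Gq (r, x, y)"
    by (rule vanishes_order_ge_rescale[OF q]) (rule that; assumption)
  obtain l1 l2 where l12: "l = (l1, l2)" "cmod l1 = 1" "cmod l2 = 1"
    using l by (cases l) (auto simp: torus2_def)
  then have "l1 \<noteq> 0" "l2 \<noteq> 0" by auto
  \<comment> \<open>The direction \<open>(- l1, - l2 * s)\<close> points radially inwards in both
    coordinates.\<close>
  then obtain s :: real where "s > 0" and "of_real s \<notin> {s. Gp (0, - l1, - l2 * s) = 0}"
    using ex_pos_real_notin_finite[OF Gp(3)[of "- l1" "- l2"]] by auto
  then have Gp0: "Gp (0, - l1, - l2 * s) \<noteq> 0" by simp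
  define H where "H t = Gp (of_real t, - l1, - l2 * s)" for t :: real
  define m where "m = cmod (H 0) / 2"
  have "m > 0" using Gp0 by (simp add: m_def H_def)
  have "isCont H 0"
    unfolding H_def
  proof (rule isCont_o2[where g = Gp])
    show "isCont (\<lambda>t. (complex_of_real t, - l1, - l2 * s)) 0" by (intro continuous_intros)
    show "isCont Gp (complex_of_real 0, - l1, - l2 * s)"
      using Gp(1) unfolding continuous_on_eq_continuous_at[OF open_UNIV] by blast
  qed
  then have "\<forall>\<^sub>F t in nhds 0. m < cmod (H t)"
    using \<open>m > 0\<close> by (intro isCont_imp_eventually_norm_greater) (simp_all add: m_def)
  then obtain \<delta>0 where \<delta>0: "\<delta>0 > 0" "\<And>t. \<bar>t\<bar> < \<delta>0 \<Longrightarrow> m < cmod (H t)"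
    unfolding eventually_nhds_metric by (auto simp: dist_real_def)
  \<comment> \<open>Rescaled points of \<open>Gamma c l\<close> have \<open>cmod x = 1\<close> and
    \<open>cmod y \<le> c\<close>.\<close>
  have "compact (Gq ` (cball 0 1 \<times> cball 0 1 \<times> cball 0 c))"
    using Gq(1) by (intro compact_continuous_image compact_Times) (auto intro: continuous_on_subset)
  then obtain C where C: "\<And>w. w \<in> cball 0 1 \<times> cball 0 1 \<times> cball 0 c \<Longrightarrow> cmod (Gq w) \<le> C"
    using compact_imp_bounded by (metis bounded_iff imageI)
  \<comment> \<open>Both coordinates of \<open>w - z\<close> will be at most
    \<open>(1 + s + c) * t\<close>, and \<open>t\<close> is at most \<open>c\<close> times either
    distance to the unit circle.\<close>
  define K where "K = 1 + c * (1 + s + c)"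
  define n where "n = deg1 p + degree p"
  \<comment> \<open>The bound \<open>1 / s\<close> gives \<open>t * s < 1\<close>, so
    \<open>snd w\<close>, of modulus \<open>1 - t * s\<close>, stays in the disk.\<close>
  define \<delta> where "\<delta> = min \<delta>0 (min 1 (1 / s))"
  have "\<delta> > 0" using \<delta>0(1) \<open>s > 0\<close> by (simp add: \<delta>_def)
  moreover have "cmod (eval2 q z / eval2 p z) \<le> C * K ^ n / m"
    if z: "z \<in> Gamma c l" and "dist z l < \<delta>" for z
  proof -
    obtain z1 z2 where z12: "z = (z1, z2)" by (cases z)
    define t where "t = cmod (z1 - l1)"
    have "z \<in> disk2" using z by (simp add: Gamma_def)
    then have zd: "cmod z1 < 1" "cmod z2 < 1" by (auto simp: disk2_def z12)
    have \<Gamma>: "[t, cmod (z2 - l2), 1 - cmod z1, 1 - cmod z2] ! i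
        \<le> c * [t, cmod (z2 - l2), 1 - cmod z1, 1 - cmod z2] ! j" if "i < 4" "j < 4" for i j
      using z that by (simp add: Gamma_def z12 l12(1) t_def Let_def)
    have t2: "cmod (z2 - l2) \<le> c * t" using \<Gamma>[of 1 0] by simp
    have t3: "t \<le> c * (1 - cmod z1)" using \<Gamma>[of 0 2] by simp
    have t4: "t \<le> c * (1 - cmod z2)" using \<Gamma>[of 0 3] by simp
    have "t \<le> dist z l" using dist_fst_le[of z l] by (simp add: z12 l12(1) t_def dist_norm)
    then have "t < \<delta>" using \<open>dist z l < \<delta>\<close> by simp
    have "t > 0" using zd(1) l12(2) by (auto simp: t_def)
    have ts: "t < 1" "t < \<delta>0" "t * s < 1"
      using \<open>t < \<delta>\<close> \<open>s > 0\<close> by (auto simp: \<delta>_def field_simps)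
    define x where "x = (z1 - l1) / t"
    define y where "y = (z2 - l2) / t"
    have zxy: "z = l + (of_real t * x, of_real t * y)"
      using \<open>t > 0\<close> by (simp add: z12 l12(1) x_def y_def)
    have "cmod x = 1" "cmod y \<le> c"
      using \<open>t > 0\<close> t2 by (auto simp: x_def y_def norm_divide t_def divide_le_eq)
    then have "cmod (Gq (of_real t, x, y)) \<le> C"
      using \<open>t > 0\<close> ts(1) by (intro C) auto
    then have q_le: "cmod (eval2 q z) \<le> t ^ M * C"
      using \<open>t > 0\<close> by (simp add: zxy Gq(2) norm_mult norm_power)
    define w where "w = l + (of_real t * (- l1), of_real t * (- l2 * s))"
    have w12: "fst w = l1 - t * l1" "snd w = l2 * of_real (1 - t * s)"
      by (simp_all add: w_def l12(1) algebra_simps)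
    have "t ^ M * m \<le> cmod (eval2 p w)"
      using \<delta>0(2)[of t] \<open>t > 0\<close> ts unfolding w_def Gp(2)
      by (simp add: H_def norm_mult norm_power)
    also have "\<dots> \<le> K ^ n * cmod (eval2 p z)"
      unfolding n_def
    proof (rule zero_free_eval2_harnack[OF nz \<open>z \<in> disk2\<close>])
      show "cmod (snd w) < 1"
        unfolding w12 norm_mult l12 norm_of_real using ts(3) \<open>t > 0\<close> \<open>s > 0\<close> by simp
      have "cmod (fst w - fst z) \<le> t + t"
        using norm_triangle_ineq4[of "l1 - z1" "t * l1"] \<open>t > 0\<close>
        by (simp add: w12 z12 norm_mult l12 t_def norm_minus_commute algebra_simps)
      also have "\<dots> \<le> (1 + s + c) * t"
        unfolding mult_2[symmetric]
        using \<open>c > 1\<close> \<open>s > 0\<close> \<open>t > 0\<close> by (intro mult_right_mono) auto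
      also have "\<dots> \<le> (1 + s + c) * (c * (1 - cmod z1))"
        using t3 \<open>c > 1\<close> \<open>s > 0\<close> by (intro mult_left_mono) auto
      finally show "cmod (fst w - fst z) \<le> (K - 1) * (1 - cmod (fst z))"
        by (simp add: K_def z12 mult_ac)
      have "cmod (snd w - snd z) \<le> c * t + t * s"
        using norm_triangle_ineq4[of "l2 - z2" "l2 * of_real (t * s)"] t2 \<open>t > 0\<close> \<open>s > 0\<close>
        by (simp add: w12 z12 norm_mult l12 norm_minus_commute algebra_simps)
      also have "\<dots> \<le> (1 + s + c) * t"
        using \<open>t > 0\<close> by (simp add: algebra_simps)
      also have "\<dots> \<le> (1 + s + c) * (c * (1 - cmod z2))"
        using t4 \<open>c > 1\<close> \<open>s > 0\<close> by (intro mult_left_mono) auto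
      finally show "cmod (snd w - snd z) \<le> (K - 1) * (1 - cmod (snd z))"
        by (simp add: K_def z12 mult_ac)
    qed
    finally have p_ge: "t ^ M * m \<le> K ^ n * cmod (eval2 p z)" .
    have "C \<ge> 0" using \<open>cmod (Gq (of_real t, x, y)) \<le> C\<close> norm_ge_zero order_trans by blast
    have "cmod (eval2 q z) * m \<le> C * (t ^ M * m)"
      using q_le \<open>m > 0\<close> by (simp add: mult_ac)
    also have "\<dots> \<le> C * (K ^ n * cmod (eval2 p z))"
      using p_ge \<open>C \<ge> 0\<close> by (intro mult_left_mono)
    finally show ?thesis
      using \<open>m > 0\<close> nz[OF \<open>z \<in> disk2\<close>] by (simp add: norm_divide divide_simps mult_ac)
  qed
  ultimately show "\<exists>\<delta>>0. \<exists>B. \<forall>z\<in>Gamma c l. dist z l < \<delta> \<longrightarrow> cmod (eval2 q z / eval2 p z) \<le> B"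
    by blast
qed

theorem theorem14p10:
  fixes p q :: "complex poly poly"
  assumes "semi_stable p"
    and "q \<in> Ip p"
  shows "(\<forall>l\<in>torus2. nt_bounded (\<lambda>z. eval2 q z / eval2 p z) l)
       \<and> (\<forall>l\<in>torus2. \<forall>M. vanishes_order p l M \<longrightarrow> vanishes_order_ge q l M)"
proof (intro conjI ballI allI impI)
  fix l :: "complex \<times> complex" assume l: "l \<in> torus2"
  show "vanishes_order_ge q l M" if "vanishes_order p l M" for M
    using Ip_vanishes_order_ge[OF l assms(2) that] .
  have nz: "\<And>z. z \<in> disk2 \<Longrightarrow> eval2 p z \<noteq> 0"
    using assms(1) by (auto simp: semi_stable_def)
  \<comment> \<open>A nonzero value at the origin excludes the zero polynomial, so \<open>p\<close>
    has a finite order at \<open>l\<close>; order 0 covers the points where \<open>p\<close> does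
    not vanish.\<close>
  then have "eval2 p (0, 0) \<noteq> 0" by (auto simp: disk2_def)
  then obtain M where "vanishes_order p l M" by (rule ex_vanishes_order)
  with nz l Ip_vanishes_order_ge[OF l assms(2)] show "nt_bounded (\<lambda>z. eval2 q z / eval2 p z) l"
    by (intro nt_bounded_divide)
qed

end
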